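(* The relaxation (DSCoMP) is equivalent to the relaxation (SCoMP).
   Context: Data: points $(\mathsf x^i,y^i)\in\mathbb R^n\times\{-1,1\}$ for $i=1,\dots,m$, a constant $C>0$, a nonnegative integer $B$ (the feature budget), and a real $M>0$ (the big-M parameter). Inequalities between vectors are componentwise; $\mathsf e$ and $\mathsf o$ denote the all-ones and all-zeros vectors; $\mathcal S_+^k$ is the set of real symmetric positive-semidefinite $k\times k$ matrices; $\operatorname{diag}\mathsf X=[X_{jj}]_{j=1}^n$ is the vector of diagonal entries of $\mathsf X$. Two minimization problems are called equivalent if they have the same optimal value. Define $$\Xi=\{(\mathsf w,b,\bm\xi)\in\mathbb R^n\times\mathbb R\times\mathbb R^m:\ y^i(\mathsf w^\top \mathsf x^i+b)\ge 1-\xi_i\ (i=1,\dots,m),\ \bm\xi\ge \mathsf o\},$$ $$\mathcal B_M=\{(\mathsf w,\mathsf u)\in\mathbb R^n\times\mathbb R^n:\ -M(\mathsf e-\mathsf u)\le\mathsf w\le M(\mathsf e-\mathsf u),\ \mathsf e^\top\mathsf u=n-B\}.$$ (SCoMP): minimize $\frac12\operatorname{trace}(\mathsf W)+C\sum_{i=1}^m\xi_i$ over $(\mathsf w,\mathsf W,b,\bm\xi,\mathsf R,\mathsf u,\mathsf U)$, with $\mathsf u\in\mathbb R^n$ and $\mathsf W,\mathsf R,\mathsf U$ real $n\times n$ matrices, subject to $(\mathsf w,b,\bm\xi)\in\Xi$, $(\mathsf w,\mathsf u)\in\mathcal B_M$, $\operatorname{diag}\mathsf R=\mathsf o$, $\operatorname{diag}\mathsf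 U=\mathsf u$, $$\begin{bmatrix}1&\mathsf w^\top&\mathsf u^\top\\ \mathsf w&\mathsf W&\mathsf R\\ \mathsf u&\mathsf R^\top&\mathsf U\end{bmatrix}\in\mathcal S_+^{2n+1}.$$ (DSCoMP): minimize $\frac12\sum_{j=1}^n W_{jj}+C\sum_{i=1}^m\xi_i$ over $(\mathsf w,\operatorname{diag}\mathsf W,b,\bm\xi,\mathsf u)$ (where only the $n$ real numbers $W_{11},\dots,W_{nn}$ are variables in place of a matrix $\mathsf W$, and $\mathsf u\in\mathbb R^n$) subject to $(\mathsf w,b,\bm\xi)\in\Xi$, $(\mathsf w,\mathsf u)\in\mathcal B_M$, $$\begin{bmatrix}1&w_j&u_j\\ w_j&W_{jj}&0\\ u_j&0&u_j\end{bmatrix}\in\mathcal S_+^3,\qquad j=1,\dots,n.$$ *)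

theory Defs
  imports "HOL-Analysis.Analysis"
begin

definition sym_psd :: "real^'k^'k \<Rightarrow> bool" where
  "sym_psd A \<longleftrightarrow> transpose A = A \<and> (\<forall>v. 0 \<le> v \<bullet> (A *v v))"

definition diag_vec :: "real^'n^'n \<Rightarrow> real^'n" where
  "diag_vec X = (\<chi> j. X $ j $ j)"

text \<open>
  The value is \<open>\<infinity>\<close> for an infeasible problem and \<open>-\<infinity>\<close> for an unbounded one;
  attainment of the minimum is not presupposed.
\<close>

definition optimal_value :: "('a \<Rightarrow> real) \<Rightarrow> 'a set \<Rightarrow> ereal" where
  "optimal_value f S = (INF z\<in>S. ereal (f z))"

definition equivalent_problems :: "('a \<Rightarrow> real) \<Rightarrow> 'a set \<Rightarrow> ('b \<Rightarrow> real) \<Rightarrow> 'b set \<Rightarrow> bool" where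
  "equivalent_problems f S g T \<longleftrightarrow> optimal_value f S = optimal_value g T"

definition Xi :: "('m \<Rightarrow> real^'n) \<Rightarrow> ('m \<Rightarrow> real) \<Rightarrow> ((real^'n) \<times> real \<times> (real^'m)) set" where
  "Xi x y = {(w, b, \<xi>). (\<forall>i. y i * (w \<bullet> x i + b) \<ge> 1 - \<xi> $ i) \<and> \<xi> \<ge> 0}"

text \<open>
  On \<^typ>\<open>real^'n\<close>, \<open>1\<close> is the all-ones vector and \<open>\<le>\<close> is componentwise.
\<close>

definition bigM_set :: "real \<Rightarrow> nat \<Rightarrow> ((real^'n) \<times> (real^'n)) set" where
  "bigM_set M B = {(w, u).
     - (M *\<^sub>R (1 - u)) \<le> w \<and> w \<le> M *\<^sub>R (1 - u) \<and>
     1 \<bullet> u = real CARD('n) - real B}"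

text \<open>
  The bordered block matrix of order \<open>2n + 1\<close>, with rows and columns indexed by
  \<^typ>\<open>unit + ('n + 'n)\<close>: \<open>Inl ()\<close> is the border index, \<open>Inr (Inl j)\<close> belongs to the
  \<open>w\<close>-block and \<open>Inr (Inr j)\<close> to the \<open>u\<close>-block.
\<close>

definition lifted_matrix ::
  "real^'n \<Rightarrow> real^'n^'n \<Rightarrow> real^'n^'n \<Rightarrow> real^'n \<Rightarrow> real^'n^'n
    \<Rightarrow> real^(unit + ('n + 'n))^(unit + ('n + 'n))" where
  "lifted_matrix w W R u U = (\<chi> p q.
     case p of
       Inl _ \<Rightarrow> (case q of
           Inl _ \<Rightarrow> 1
         | Inr (Inl k) \<Rightarrow> w $ k
         | Inr (Inr k) \<Rightarrow> u $ k)
     | Inr (Inl j) \<Rightarrow> (case q of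
           Inl _ \<Rightarrow> w $ j
         | Inr (Inl k) \<Rightarrow> W $ j $ k
         | Inr (Inr k) \<Rightarrow> R $ j $ k)
     | Inr (Inr j) \<Rightarrow> (case q of
           Inl _ \<Rightarrow> u $ j
         | Inr (Inl k) \<Rightarrow> transpose R $ j $ k
         | Inr (Inr k) \<Rightarrow> U $ j $ k))"

definition SCoMP_feasible ::
  "('m \<Rightarrow> real^'n) \<Rightarrow> ('m \<Rightarrow> real) \<Rightarrow> real \<Rightarrow> nat \<Rightarrow>
    ((real^'n) \<times> (real^'n^'n) \<times> real \<times> (real^'m) \<times> (real^'n^'n) \<times> (real^'n) \<times> (real^'n^'n)) set" where
  "SCoMP_feasible x y M B = {(w, W, b, \<xi>, R, u, U).
     (w, b, \<xi>) \<in> Xi x y \<and> (w, u) \<in> bigM_set M B \<and>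
     diag_vec R = 0 \<and> diag_vec U = u \<and>
     sym_psd (lifted_matrix w W R u U)}"

definition SCoMP_objective ::
  "real \<Rightarrow> (real^'n) \<times> (real^'n^'n) \<times> real \<times> (real^'m) \<times> (real^'n^'n) \<times> (real^'n) \<times> (real^'n^'n)
    \<Rightarrow> real" where
  "SCoMP_objective C = (\<lambda>(w, W, b, \<xi>, R, u, U).
     1/2 * trace W + C * (\<Sum>i\<in>UNIV. \<xi> $ i))"

text \<open>
  The diagonal variables \<open>W\<^sub>1\<^sub>1, \<dots>, W\<^sub>n\<^sub>n\<close> form the vector \<open>d\<close>.
\<close>

definition DSCoMP_feasible ::
  "('m \<Rightarrow> real^'n) \<Rightarrow> ('m \<Rightarrow> real) \<Rightarrow> real \<Rightarrow> nat \<Rightarrow>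
    ((real^'n) \<times> (real^'n) \<times> real \<times> (real^'m) \<times> (real^'n)) set" where
  "DSCoMP_feasible x y M B = {(w, d, b, \<xi>, u).
     (w, b, \<xi>) \<in> Xi x y \<and> (w, u) \<in> bigM_set M B \<and>
     (\<forall>j. sym_psd (vector [vector [1,     w $ j, u $ j],
                           vector [w $ j, d $ j, 0    ],
                           vector [u $ j, 0,     u $ j]] :: real^3^3))}"

definition DSCoMP_objective ::
  "real \<Rightarrow> (real^'n) \<times> (real^'n) \<times> real \<times> (real^'m) \<times> (real^'n) \<Rightarrow> real" where
  "DSCoMP_objective C = (\<lambda>(w, d, b, \<xi>, u).
     1/2 * (\<Sum>j\<in>UNIV. d $ j) + C * (\<Sum>i\<in>UNIV. \<xi> $ i))"

end

theory Submission
  imports Defs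
begin

text \<open>
  Both programs have the same set of objective values.
  The objective of (SCoMP) reads off only the trace of \<open>W\<close>, so it suffices that
  the feasible points of (DSCoMP) are exactly the shadows of those of (SCoMP) under
  \<open>(w, W, b, \<xi>, R, u, U) \<mapsto> (w, diag W, b, \<xi>, u)\<close>.

  A shadow is feasible because each \<open>3 \<times> 3\<close> block is a principal submatrix of the lifted matrix.
  Conversely, the \<open>n\<close> blocks overlap only in the border entry \<open>1\<close>, so they can be glued
  by taking Schur complements with respect to that entry. The complement of the \<open>j\<close>-th block is the
  \<open>2 \<times> 2\<close> matrix with rows \<open>(d\<^sub>j - w\<^sub>j\<^sup>2, - w\<^sub>j u\<^sub>j)\<close> and \<open>(- w\<^sub>j u\<^sub>j, u\<^sub>j - u\<^sub>j\<^sup>2)\<close>; the direct sum of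
  these complements, bordered by zeros, plus the rank-one matrix \<open>(1, w, u) (1, w, u)\<^sup>T\<close> is a positive semidefinite
  lifted matrix with the prescribed diagonals.
\<close>

lemma sum_UNIV_Plus:
  fixes f :: "'a::finite + 'b::finite \<Rightarrow> 'c::comm_monoid_add"
  shows "(\<Sum>p\<in>UNIV. f p) = (\<Sum>i\<in>UNIV. f (Inl i)) + (\<Sum>j\<in>UNIV. f (Inr j))"
  using sum.Plus[of "UNIV :: 'a set" "UNIV :: 'b set" f] by (simp add: UNIV_Plus_UNIV)

lemma inner_mult_eq_sum:
  fixes A :: "real^'n^'m"
  shows "p \<bullet> (A *v q) = (\<Sum>j\<in>UNIV. \<Sum>k\<in>UNIV. p $ j * A $ j $ k * q $ k)"
  by (simp add: inner_vec_def matrix_vector_mult_def sum_distrib_left mult.assoc)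

lemma inner_lifted_matrix:
  fixes w u :: "real^'n" and v :: "real^(unit + ('n + 'n))"
  defines "a \<equiv> v $ Inl ()" and "p \<equiv> \<chi> j. v $ Inr (Inl j)" and "q \<equiv> \<chi> j. v $ Inr (Inr j)"
  shows "v \<bullet> (lifted_matrix w W R u U *v v) =
    a\<^sup>2 + 2 * a * (w \<bullet> p + u \<bullet> q) + p \<bullet> (W *v p) + 2 * (p \<bullet> (R *v q)) + q \<bullet> (U *v q)"
  unfolding inner_mult_eq_sum a_def p_def q_def
  unfolding inner_vec_def
  apply (simp add: sum_UNIV_Plus UNIV_unit lifted_matrix_def transpose_def matrix_vector_mult_def
      sum.distrib sum_distrib_left power2_eq_square algebra_simps)
  \<comment> \<open>the contributions of \<open>R\<close> and \<open>R\<^sup>T\<close> agree after exchanging the summations\<close>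
  apply (subst sum.swap)
  apply (simp flip: sum_distrib_left)
  done

lemma transpose_lifted_matrix:
  assumes "transpose W = W" and "transpose U = U"
  shows "transpose (lifted_matrix w W R u U) = lifted_matrix w W R u U"
proof -
  have "W $ k $ j = W $ j $ k" "U $ k $ j = U $ j $ k" for j k
    using assms by (metis transpose_def vec_lambda_beta)+
  then show ?thesis
    by (auto simp: transpose_def lifted_matrix_def vec_eq_iff split: sum.splits)
qed

lemma sym_psd_block_iff:
  fixes \<omega> \<delta> \<upsilon> :: real
  shows "sym_psd (vector [vector [1, \<omega>, \<upsilon>], vector [\<omega>, \<delta>, 0], vector [\<upsilon>, 0, \<upsilon>]] :: real^3^3) \<longleftrightarrow>
    (\<forall>a s t. 0 \<le> a\<^sup>2 + 2 * a * (\<omega> * s + \<upsilon> * t) + \<delta> * s\<^sup>2 + \<upsilon> * t\<^sup>2)"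
    (is "sym_psd ?A \<longleftrightarrow> (\<forall>a s t. 0 \<le> ?q a s t)")
proof -
  have "transpose ?A = ?A"
    by (simp add: vec_eq_iff forall_3 transpose_def)
  moreover have form: "v \<bullet> (?A *v v) = ?q (v $ 1) (v $ 2) (v $ 3)" for v
    by (simp add: inner_vec_def matrix_vector_mult_def sum_3 power2_eq_square algebra_simps)
  have "(\<forall>v. 0 \<le> v \<bullet> (?A *v v)) \<longleftrightarrow> (\<forall>a s t. 0 \<le> ?q a s t)"
  proof (intro iffI allI)
    fix a s t
    assume "\<forall>v. 0 \<le> v \<bullet> (?A *v v)"
    then have "0 \<le> (vector [a, s, t] :: real^3) \<bullet> (?A *v vector [a, s, t])" by blast
    then show "0 \<le> ?q a s t" unfolding form by simp
  qed (simp add: form)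
  ultimately show ?thesis
    unfolding sym_psd_def by simp
qed

text \<open>
  The constraints on \<open>diag R\<close> and \<open>diag U\<close> say exactly that the block is the principal
  submatrix on the border index and the two copies of \<open>j\<close>: test the lifted matrix on vectors
  supported there.
\<close>

lemma sym_psd_block_of_lifted_matrix:
  fixes w u :: "real^'n"
  assumes psd: "sym_psd (lifted_matrix w W R u U)" and R: "diag_vec R = 0" and U: "diag_vec U = u"
  shows "sym_psd (vector [vector [1, w $ j, u $ j], vector [w $ j, diag_vec W $ j, 0],
                          vector [u $ j, 0, u $ j]] :: real^3^3)"
  unfolding sym_psd_block_iff
proof (intro allI)
  fix a s t :: real
  define v :: "real^(unit + ('n + 'n))" where
    "v = (\<chi> i. case i of Inl _ \<Rightarrow> a
                | Inr (Inl k) \<Rightarrow> (axis j s :: real^'n) $ k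
                | Inr (Inr k) \<Rightarrow> (axis j t :: real^'n) $ k)"
  have v: "v $ Inl () = a" "(\<chi> k. v $ Inr (Inl k)) = axis j s" "(\<chi> k. v $ Inr (Inr k)) = axis j t"
    by (simp_all add: v_def)
  have entry: "axis j \<sigma> \<bullet> (A *v axis j \<tau>) = \<sigma> * A $ j $ j * \<tau>" for \<sigma> \<tau> and A :: "real^'n^'n"
    unfolding inner_axis'
    by (simp add: matrix_vector_mult_def axis_def if_distrib cong: if_cong)
  have "R $ j $ j = 0" "U $ j $ j = u $ j"
    using R U by (simp_all add: diag_vec_def vec_eq_iff)
  then have "v \<bullet> (lifted_matrix w W R u U *v v) =
      a\<^sup>2 + 2 * a * (w $ j * s + u $ j * t) + diag_vec W $ j * s\<^sup>2 + u $ j * t\<^sup>2"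
    unfolding inner_lifted_matrix v entry
    by (simp add: inner_axis diag_vec_def power2_eq_square)
  with psd show "0 \<le> a\<^sup>2 + 2 * a * (w $ j * s + u $ j * t) + diag_vec W $ j * s\<^sup>2 + u $ j * t\<^sup>2"
    unfolding sym_psd_def by metis
qed

text \<open>
  The rank-one matrix \<open>p q\<^sup>T\<close> with its diagonal replaced by \<open>d\<close>. With \<open>p, q \<in> {w, u}\<close> these are the
  blocks of the glued matrix: the direct sum of Schur complements has entries only on the
  diagonals of the blocks.
\<close>

definition outer_with_diag :: "real^'n \<Rightarrow> real^'n \<Rightarrow> real^'n \<Rightarrow> real^'n^'n" where
  "outer_with_diag p q d = (\<chi> j k. if j = k then d $ j else p $ j * q $ k)"

lemma diag_vec_outer_with_diag [simp]: "diag_vec (outer_with_diag p q d) = d"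
  by (simp add: diag_vec_def outer_with_diag_def vec_eq_iff)

lemma transpose_outer_with_diag_same: "transpose (outer_with_diag p p d) = outer_with_diag p p d"
  by (simp add: transpose_def outer_with_diag_def vec_eq_iff)

lemma inner_outer_with_diag:
  "r \<bullet> (outer_with_diag p q d *v s) =
    (p \<bullet> r) * (q \<bullet> s) + (\<Sum>j\<in>UNIV. (d $ j - p $ j * q $ j) * r $ j * s $ j)"
proof -
  have "r \<bullet> (outer_with_diag p q d *v s) =
      (\<Sum>j\<in>UNIV. \<Sum>k\<in>UNIV. (p $ j * r $ j) * (q $ k * s $ k)
         + (if j = k then (d $ j - p $ j * q $ j) * r $ j * s $ j else 0))"
    unfolding inner_mult_eq_sum
    by (intro sum.cong refl) (simp add: outer_with_diag_def algebra_simps)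
  also have "\<dots> = (p \<bullet> r) * (q \<bullet> s) + (\<Sum>j\<in>UNIV. (d $ j - p $ j * q $ j) * r $ j * s $ j)"
    by (simp add: sum.distrib inner_vec_def sum_product)
  finally show ?thesis .
qed

text \<open>
  The quadratic form of the glued matrix is the square of the inner product with \<open>(1, w, u)\<close> plus,
  for each \<open>j\<close>, the form of the \<open>j\<close>-th Schur complement, which is the minimum of the form
  of the \<open>j\<close>-th block over its border coordinate.
\<close>

lemma sym_psd_lifted_matrix_glue:
  fixes w u d :: "real^'n"
  assumes blocks: "\<And>j. sym_psd (vector [vector [1, w $ j, u $ j], vector [w $ j, d $ j, 0],
                                        vector [u $ j, 0, u $ j]] :: real^3^3)"
  shows "sym_psd (lifted_matrix w (outer_with_diag w w d) (outer_with_diag w u 0)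
                    u (outer_with_diag u u u))"
  unfolding sym_psd_def
proof (intro conjI allI transpose_lifted_matrix transpose_outer_with_diag_same)
  fix v :: "real^(unit + ('n + 'n))"
  define a where "a = v $ Inl ()"
  define p where "p = (\<chi> j. v $ Inr (Inl j))"
  define q where "q = (\<chi> j. v $ Inr (Inr j))"
  let ?schur = "\<lambda>j. (d $ j - w $ j * w $ j) * p $ j * p $ j
      + 2 * ((0 - w $ j * u $ j) * p $ j * q $ j) + (u $ j - u $ j * u $ j) * q $ j * q $ j"
  have "0 \<le> ?schur j" for j
  proof -
    \<comment> \<open>the value of the border coordinate that minimizes the form of the block\<close>
    let ?a = "- (w $ j * p $ j + u $ j * q $ j)"
    have "0 \<le> ?a\<^sup>2 + 2 * ?a * (w $ j * p $ j + u $ j * q $ j) + d $ j * (p $ j)\<^sup>2 + u $ j * (q $ j)\<^sup>2"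
      using blocks[of j] unfolding sym_psd_block_iff by blast
    also have "\<dots> = ?schur j"
      by (simp add: power2_eq_square algebra_simps)
    finally show ?thesis .
  qed
  then have "0 \<le> (a + w \<bullet> p + u \<bullet> q)\<^sup>2 + (\<Sum>j\<in>UNIV. ?schur j)"
    by (intro add_nonneg_nonneg[OF zero_le_power2 sum_nonneg])
  also have "(\<Sum>j\<in>UNIV. ?schur j) = (\<Sum>j\<in>UNIV. (d $ j - w $ j * w $ j) * p $ j * p $ j)
      + 2 * (\<Sum>j\<in>UNIV. (0 $ j - w $ j * u $ j) * p $ j * q $ j)
      + (\<Sum>j\<in>UNIV. (u $ j - u $ j * u $ j) * q $ j * q $ j)"
    by (simp add: sum.distrib sum_subtractf sum_negf sum_distrib_left)
  also have "(a + w \<bullet> p + u \<bullet> q)\<^sup>2 + \<dots> =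
      v \<bullet> (lifted_matrix w (outer_with_diag w w d) (outer_with_diag w u 0)
             u (outer_with_diag u u u) *v v)"
    unfolding inner_lifted_matrix inner_outer_with_diag a_def[symmetric] p_def[symmetric] q_def[symmetric]
    by (simp add: power2_eq_square algebra_simps)
  finally show "0 \<le> v \<bullet> (lifted_matrix w (outer_with_diag w w d) (outer_with_diag w u 0)
                            u (outer_with_diag u u u) *v v)" .
qed

lemma trace_eq_sum_diag_vec: "trace W = (\<Sum>j\<in>UNIV. diag_vec W $ j)"
  by (simp add: trace_def diag_vec_def)

lemma DSCoMP_feasible_eq_image:
  "DSCoMP_feasible x y M B =
    (\<lambda>(w, W, b, \<xi>, R, u, U). (w, diag_vec W, b, \<xi>, u)) ` SCoMP_feasible x y M B"
  (is "?D = ?shadow ` ?S")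
proof
  show "?shadow ` ?S \<subseteq> ?D"
    by (auto simp: SCoMP_feasible_def DSCoMP_feasible_def intro: sym_psd_block_of_lifted_matrix)
  show "?D \<subseteq> ?shadow ` ?S"
  proof
    fix z assume z: "z \<in> ?D"
    obtain w d b \<xi> u where z_eq: "z = (w, d, b, \<xi>, u)" by (cases z)
    let ?z = "(w, outer_with_diag w w d, b, \<xi>, outer_with_diag w u 0, u, outer_with_diag u u u)"
    have "?z \<in> ?S"
      using z unfolding z_eq
      by (auto simp: SCoMP_feasible_def DSCoMP_feasible_def intro: sym_psd_lifted_matrix_glue)
    moreover have "z = ?shadow ?z" by (simp add: z_eq)
    ultimately show "z \<in> ?shadow ` ?S" by (rule rev_image_eqI)
  qed
qed

theorem corollary3p7:
  fixes x :: "'m::finite \<Rightarrow> real^'n" and y :: "'m \<Rightarrow> real"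
    and C M :: real and B :: nat
  assumes "\<And>i. y i \<in> {-1, 1}" and "C > 0" and "M > 0"
  shows "equivalent_problems
           (DSCoMP_objective C) (DSCoMP_feasible x y M B)
           (SCoMP_objective C) (SCoMP_feasible x y M B)"
  unfolding equivalent_problems_def optimal_value_def DSCoMP_feasible_eq_image image_image
  by (intro INF_cong refl)
    (auto simp: DSCoMP_objective_def SCoMP_objective_def trace_eq_sum_diag_vec)

end
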